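(* Let $1<p\leq 2\leq q<\infty$ and let $\frac1p+\frac1{p'}=1$. There is a constant $C_{p,q}>0$ depending only on $p$ and $q$ such that for every left-invariant operator $A$ on $\mathrm{SU}(2)$, with symbol $\sigma_A$, that extends to a bounded operator from $L^p(\mathrm{SU}(2))$ to $L^q(\mathrm{SU}(2))$, both of the following hold: $$\sup_{l\in\frac12\mathbb{N}_0}\frac{\min_{n\in\{-l,-l+1,\ldots,l\}}|\sigma_A(l)_{nn}|}{(2l+1)^{\frac1{p'}+\frac1q}}\leq C_{p,q}\,\|A\|_{L^p(\mathrm{SU}(2))\to L^q(\mathrm{SU}(2))},$$ $$\sup_{l\in\frac12\mathbb{N}_0}\frac{|\operatorname{Tr}\sigma_A(l)|}{(2l+1)^{1+\frac1{p'}+\frac1q}}\leq C_{p,q}\,\|A\|_{L^p(\mathrm{SU}(2))\to L^q(\mathrm{SU}(2))}.$$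
   Context: $\mathrm{SU}(2)$ carries the normalized Haar measure $du$, and $\frac12\mathbb{N}_0=\{0,\frac12,1,\frac32,\dots\}$. For $l\in\frac12\mathbb{N}_0$, let $V_l$ be the $(2l+1)$-dimensional space of homogeneous polynomials of degree $2l$ in two complex variables $z=(z_1,z_2)$ (a row vector), and let $t^l$ be the irreducible representation $(t^l(u)P)(z)=P(zu)$ of $\mathrm{SU}(2)$ on $V_l$, written as a unitary matrix representation $t^l:\mathrm{SU}(2)\to\mathrm{U}(2l+1)$ in the standard basis $z_1^{l-n}z_2^{l+n}/\sqrt{(l-n)!\,(l+n)!}$, $n=-l,-l+1,\dots,l$; matrix rows and columns are indexed by $n\in\{-l,-l+1,\dots,l\}$. The Fourier coefficient of $f$ is the matrix $\widehat f(l)=\int_{\mathrm{SU}(2)}f(u)\,t^l(u)^*\,du\in\mathbb{C}^{(2l+1)\times(2l+1)}$ (extended to distributions by duality). A left-invariant operator on $\mathrm{SU}(2)$ is a continuous linear operator $A:C^\infty(\mathrm{SU}(2))\to\mathcal{D}'(\mathrm{SU}(2))$ commuting with all left translations $\tau_gf(x)=f(g^{-1}x)$. Such an operator is a Fourier multiplier: there are matrices $\sigma_A(l)\in\mathbb{C}^{(2l+1)\times(2l+1)}$ (the symbol of $A$) with $\widehat{Af}(l)=\sigma_A(l)\widehat f(l)$ for all $f\in C^\infty(\mathrm{SU}(2))$ and $l\in\frac12\mathbb{N}_0$. $\|A\|_{L^p\to L^q}$ denotes the norm of the bounded extension. *)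

theory Defs
  imports "HOL-Analysis.Analysis"
begin

section \<open>The group SU(2) and its Haar measure\<close>

type_synonym cmat2 = "complex^2^2"

definition SU2 :: "cmat2 set" where
  "SU2 = {u. u ** (\<chi> i j. cnj (u $ j $ i)) = mat 1 \<and> det u = 1}"

text \<open>Functions on SU(2) are represented by functions on the whole matrix type. Every notion
  below depends on their values on SU(2) only.\<close>

definition normalized_haar_SU2 :: "cmat2 measure \<Rightarrow> bool" where
  "normalized_haar_SU2 \<mu> \<longleftrightarrow>
     sets \<mu> = sets (restrict_space borel SU2) \<and>
     emeasure \<mu> SU2 = 1 \<and>
     (\<forall>g\<in>SU2. distr \<mu> \<mu> (\<lambda>u. g ** u) = \<mu>)"

definition left_translate :: "cmat2 \<Rightarrow> (cmat2 \<Rightarrow> complex) \<Rightarrow> cmat2 \<Rightarrow> complex" where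
  "left_translate g f = (\<lambda>x. f (matrix_inv g ** x))"

section \<open>Smooth functions and distributions\<close>

datatype axis = AxisX | AxisY | AxisZ

fun pauli :: "axis \<Rightarrow> cmat2" where
  "pauli AxisX = vector [vector [0, 1], vector [1, 0]]"
| "pauli AxisY = vector [vector [0, - \<i>], vector [\<i>, 0]]"
| "pauli AxisZ = vector [vector [1, 0], vector [0, - 1]]"

text \<open>The one-parameter subgroup \<open>t \<mapsto> exp (\<i> t s / 2)\<close> for a Pauli matrix \<open>s\<close>; since \<open>s\<close> squares
  to the identity, the exponential is \<open>cos (t/2) + \<i> sin (t/2) s\<close>. The three matrices \<open>\<i> s / 2\<close>
  are a basis of the Lie algebra su(2).\<close>

definition one_param :: "axis \<Rightarrow> real \<Rightarrow> cmat2" where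
  "one_param a t = mat (complex_of_real (cos (t / 2)))
     + mat (\<i> * complex_of_real (sin (t / 2))) ** pauli a"

lemma one_param_in_SU2: "one_param a t \<in> SU2"
  unfolding SU2_def one_param_def
  by (cases a) (auto simp: vec_eq_iff matrix_matrix_mult_def sum_2 forall_2 mat_def det_2
      algebra_simps complex_eq_iff)

definition lie_deriv :: "axis \<Rightarrow> (cmat2 \<Rightarrow> complex) \<Rightarrow> cmat2 \<Rightarrow> complex" where
  "lie_deriv a f = (\<lambda>u. vector_derivative (\<lambda>t. f (u ** one_param a t)) (at 0))"

fun iter_deriv :: "axis list \<Rightarrow> (cmat2 \<Rightarrow> complex) \<Rightarrow> cmat2 \<Rightarrow> complex" where
  "iter_deriv [] f = f"
| "iter_deriv (a # w) f = lie_deriv a (iter_deriv w f)"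

text \<open>The left-invariant vector fields \<open>lie_deriv a\<close> form a global frame of the tangent bundle, so
  a function is smooth iff all its iterated derivatives along them exist and are continuous.\<close>

definition smooth_SU2 :: "(cmat2 \<Rightarrow> complex) \<Rightarrow> bool" where
  "smooth_SU2 f \<longleftrightarrow> (\<forall>w. continuous_on SU2 (iter_deriv w f) \<and>
     (\<forall>a. \<forall>u\<in>SU2. (\<lambda>t. iter_deriv w f (u ** one_param a t)) differentiable (at 0)))"

definition smooth_tendsto :: "(nat \<Rightarrow> cmat2 \<Rightarrow> complex) \<Rightarrow> (cmat2 \<Rightarrow> complex) \<Rightarrow> bool" where
  "smooth_tendsto F f \<longleftrightarrow>
     (\<forall>w. uniform_limit SU2 (\<lambda>n. iter_deriv w (F n)) (iter_deriv w f) sequentially)"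

text \<open>A distribution is a continuous linear functional on the smooth functions. The topology of
  the latter is given by countably many seminorms, so it is metrizable and continuity is
  sequential continuity.\<close>

definition distribution_SU2 :: "((cmat2 \<Rightarrow> complex) \<Rightarrow> complex) \<Rightarrow> bool" where
  "distribution_SU2 T \<longleftrightarrow>
     (\<forall>f g. smooth_SU2 f \<longrightarrow> smooth_SU2 g \<longrightarrow> T (\<lambda>x. f x + g x) = T f + T g) \<and>
     (\<forall>c f. smooth_SU2 f \<longrightarrow> T (\<lambda>x. c * f x) = c * T f) \<and>
     (\<forall>F f. (\<forall>n. smooth_SU2 (F n)) \<longrightarrow> smooth_SU2 f \<longrightarrow> smooth_tendsto F f \<longrightarrow>
        (\<lambda>n. T (F n)) \<longlonglongrightarrow> T f)"

definition distribution_of ::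
  "cmat2 measure \<Rightarrow> (cmat2 \<Rightarrow> complex) \<Rightarrow> (cmat2 \<Rightarrow> complex) \<Rightarrow> complex" where
  "distribution_of \<mu> f = (\<lambda>\<phi>. LINT u|\<mu>. f u * \<phi> u)"

section \<open>Left-invariant operators\<close>

text \<open>\<open>A f \<phi>\<close> is the value of the distribution \<open>A f\<close> at the test function \<open>\<phi>\<close>. The space of
  distributions carries the topology of pointwise convergence on test functions, so continuity
  and linearity of \<open>A\<close> say that \<open>f \<mapsto> A f \<phi>\<close> is again a continuous linear functional, for
  every \<open>\<phi>\<close>.\<close>

definition continuous_linear_operator ::
  "((cmat2 \<Rightarrow> complex) \<Rightarrow> (cmat2 \<Rightarrow> complex) \<Rightarrow> complex) \<Rightarrow> bool" where
  "continuous_linear_operator A \<longleftrightarrow>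
     (\<forall>f. smooth_SU2 f \<longrightarrow> distribution_SU2 (A f)) \<and>
     (\<forall>\<phi>. smooth_SU2 \<phi> \<longrightarrow> distribution_SU2 (\<lambda>f. A f \<phi>))"

text \<open>Left translation by \<open>g\<close> acts on distributions by duality: the translate of \<open>T\<close> sends \<open>\<phi>\<close> to
  \<open>T (left_translate (matrix_inv g) \<phi>)\<close>, in accordance with invariance of the Haar measure.\<close>

definition left_invariant_operator ::
  "((cmat2 \<Rightarrow> complex) \<Rightarrow> (cmat2 \<Rightarrow> complex) \<Rightarrow> complex) \<Rightarrow> bool" where
  "left_invariant_operator A \<longleftrightarrow> continuous_linear_operator A \<and>
     (\<forall>g\<in>SU2. \<forall>f \<phi>. smooth_SU2 f \<longrightarrow> smooth_SU2 \<phi> \<longrightarrow>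
        A (left_translate g f) \<phi> = A f (left_translate (matrix_inv g) \<phi>))"

section \<open>Representations, Fourier coefficients and symbols\<close>

text \<open>The half-integer \<open>l\<close> is encoded by the natural number \<open>k = 2 l\<close>, and a row or column index
  \<open>n \<in> {-l, -l+1, \<dots>, l}\<close> by \<open>i = l + n \<in> {0..k}\<close>, so that \<open>l - n = k - i\<close>. A matrix of size
  \<open>2 l + 1\<close> is a function of two natural numbers, of which only the entries with indices at most
  \<open>k\<close> are relevant.\<close>

definition std_basis :: "nat \<Rightarrow> nat \<Rightarrow> complex^2 \<Rightarrow> complex" where
  "std_basis k i z = (z $ 1) ^ (k - i) * (z $ 2) ^ i / complex_of_real (sqrt (fact (k - i) * fact i))"

definition rep :: "cmat2 \<Rightarrow> (complex^2 \<Rightarrow> complex) \<Rightarrow> complex^2 \<Rightarrow> complex" where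
  "rep u P = (\<lambda>z. P (z v* u))"

text \<open>Column \<open>j\<close> of the matrix of \<open>rep u\<close> consists of the coordinates of the image of the \<open>j\<close>-th
  basis vector.\<close>

definition rep_matrix :: "nat \<Rightarrow> cmat2 \<Rightarrow> nat \<Rightarrow> nat \<Rightarrow> complex" where
  "rep_matrix k u i j =
     (THE c. (\<forall>m>k. c m = 0) \<and> (\<forall>z. rep u (std_basis k j) z = (\<Sum>m\<le>k. c m * std_basis k m z))) i"

definition fourier_coeff ::
  "cmat2 measure \<Rightarrow> (cmat2 \<Rightarrow> complex) \<Rightarrow> nat \<Rightarrow> nat \<Rightarrow> nat \<Rightarrow> complex" where
  "fourier_coeff \<mu> f k i j = (LINT u|\<mu>. f u * cnj (rep_matrix k u j i))"

definition fourier_coeff_dist ::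
  "((cmat2 \<Rightarrow> complex) \<Rightarrow> complex) \<Rightarrow> nat \<Rightarrow> nat \<Rightarrow> nat \<Rightarrow> complex" where
  "fourier_coeff_dist T k i j = T (\<lambda>u. cnj (rep_matrix k u j i))"

definition is_symbol ::
  "cmat2 measure \<Rightarrow> ((cmat2 \<Rightarrow> complex) \<Rightarrow> (cmat2 \<Rightarrow> complex) \<Rightarrow> complex)
     \<Rightarrow> (nat \<Rightarrow> nat \<Rightarrow> nat \<Rightarrow> complex) \<Rightarrow> bool" where
  "is_symbol \<mu> A \<sigma> \<longleftrightarrow> (\<forall>f. smooth_SU2 f \<longrightarrow> (\<forall>k. \<forall>i\<le>k. \<forall>j\<le>k.
     fourier_coeff_dist (A f) k i j = (\<Sum>m\<le>k. \<sigma> k i m * fourier_coeff \<mu> f k m j)))"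

section \<open>Bounded operators between Lebesgue spaces\<close>

text \<open>Elements of the Lebesgue spaces are represented by functions, operators by maps of
  functions. The norm bound makes such a map compatible with equality almost everywhere.\<close>

definition Lp_space :: "'a measure \<Rightarrow> real \<Rightarrow> ('a \<Rightarrow> complex) set" where
  "Lp_space M p = {f \<in> borel_measurable M. integrable M (\<lambda>x. norm (f x) powr p)}"

definition Lp_norm :: "'a measure \<Rightarrow> real \<Rightarrow> ('a \<Rightarrow> complex) \<Rightarrow> real" where
  "Lp_norm M p f = (LINT x|M. norm (f x) powr p) powr (1 / p)"

definition bounded_Lp_Lq_operator ::
  "'a measure \<Rightarrow> real \<Rightarrow> real \<Rightarrow> (('a \<Rightarrow> complex) \<Rightarrow> 'a \<Rightarrow> complex) \<Rightarrow> bool" where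
  "bounded_Lp_Lq_operator M p q B \<longleftrightarrow>
     (\<forall>f\<in>Lp_space M p. B f \<in> Lp_space M q) \<and>
     (\<forall>f\<in>Lp_space M p. \<forall>g\<in>Lp_space M p. AE x in M. B (\<lambda>y. f y + g y) x = B f x + B g x) \<and>
     (\<forall>c. \<forall>f\<in>Lp_space M p. AE x in M. B (\<lambda>y. c * f y) x = c * B f x) \<and>
     (\<exists>K. \<forall>f\<in>Lp_space M p. Lp_norm M q (B f) \<le> K * Lp_norm M p f)"

definition Lp_Lq_onorm ::
  "'a measure \<Rightarrow> real \<Rightarrow> real \<Rightarrow> (('a \<Rightarrow> complex) \<Rightarrow> 'a \<Rightarrow> complex) \<Rightarrow> real" where
  "Lp_Lq_onorm M p q B = (SUP f\<in>Lp_space M p. Lp_norm M q (B f) / Lp_norm M p f)"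

definition bounded_Lp_Lq_extension ::
  "cmat2 measure \<Rightarrow> real \<Rightarrow> real \<Rightarrow> ((cmat2 \<Rightarrow> complex) \<Rightarrow> (cmat2 \<Rightarrow> complex) \<Rightarrow> complex)
     \<Rightarrow> ((cmat2 \<Rightarrow> complex) \<Rightarrow> cmat2 \<Rightarrow> complex) \<Rightarrow> bool" where
  "bounded_Lp_Lq_extension \<mu> p q A B \<longleftrightarrow> bounded_Lp_Lq_operator \<mu> p q B \<and>
     (\<forall>f \<phi>. smooth_SU2 f \<longrightarrow> smooth_SU2 \<phi> \<longrightarrow> A f \<phi> = distribution_of \<mu> (B f) \<phi>)"

end

theory Submission
  imports Defs "HOL-Computational_Algebra.Polynomial" "HOL-Probability.Probability_Measure"
begin

text \<open>Every diagonal entry of the symbol is bounded by the operator norm, which gives both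
  estimates with constant 1. Let \<open>t\<close> be the matrix coefficient in row \<open>j\<close> and column \<open>i\<close> of the
  representation. Coefficients in one row and two distinct columns are orthogonal, because right
  translation by a diagonal matrix multiplies them by distinct phases; hence pairing \<open>A t\<close> with the
  conjugate of \<open>t\<close> yields \<open>\<sigma> k i i\<close> times the squared L2 norm of \<open>t\<close>. On the other hand the pairing is
  at most the operator norm times the squared L2 norm, since \<open>p \<le> 2 \<le> q\<close> and the Haar measure
  has total mass 1. As the columns of an invertible matrix are nonzero, some row \<open>j\<close> gives \<open>t \<noteq> 0\<close>.\<close>

section \<open>Lebesgue norms on a probability space\<close>

text \<open>Young's inequality with weights \<open>p / q\<close> and \<open>1 - p / q\<close>,
  applied pointwise, gives integrability. Integrated after scaling \<open>f\<close> to
  \<open>q\<close>-norm 1, it compares the norms; the constant is 1 because the total mass is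
  1.\<close>

lemma (in prob_space) Lp_space_mono:
  fixes f :: "'a \<Rightarrow> complex"
  assumes "0 < p" "p \<le> q" and f: "f \<in> Lp_space M q"
  shows "f \<in> Lp_space M p" and "Lp_norm M p f \<le> Lp_norm M q f"
proof -
  have [measurable]: "f \<in> borel_measurable M"
    and int_q: "integrable M (\<lambda>x. norm (f x) powr q)"
    using f by (auto simp: Lp_space_def)
  have q: "0 < q" using assms by simp
  have young: "t powr p \<le> p / q * t powr q + (1 - p / q)" if "0 \<le> t" for t :: real
  proof (cases "t = 0")
    case True
    then show ?thesis using assms q by simp
  next
    case False
    have "(t powr q) powr (p / q) * 1 powr (1 - p / q) \<le> p / q * t powr q + (1 - p / q) * 1"
      using assms q that False by (intro Youngs_inequality_0) auto
    then show ?thesis using q by (simp add: powr_powr)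
  qed
  have int_p: "integrable M (\<lambda>x. norm (f x) powr p)"
  proof (rule Bochner_Integration.integrable_bound)
    show "integrable M (\<lambda>x. p / q * norm (f x) powr q + (1 - p / q))"
      using int_q by simp
    show "AE x in M. norm (norm (f x) powr p) \<le> norm (p / q * norm (f x) powr q + (1 - p / q))"
      using young by (auto simp: abs_if intro!: AE_I2 order_trans[OF young])
  qed measurable
  then show "f \<in> Lp_space M p" by (simp add: Lp_space_def)
  define s where "s = Lp_norm M q f"
  define I where "I = (LINT x|M. norm (f x) powr q)"
  have I0: "0 \<le> I" unfolding I_def by (intro integral_nonneg_AE) auto
  show "Lp_norm M p f \<le> Lp_norm M q f"
  \<comment> \<open>Scaling by \<open>s\<close> requires a nonzero norm; if \<open>I = 0\<close>
    then \<open>f\<close> vanishes almost everywhere and the left-hand norm is 0.\<close>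
  proof (cases "I = 0")
    case True
    then have "AE x in M. norm (f x) powr q = 0"
      using int_q unfolding I_def by (subst (asm) integral_nonneg_eq_0_iff_AE) auto
    then have "AE x in M. norm (f x) powr p = 0" by simp
    then have "(LINT x|M. norm (f x) powr p) = 0"
      by (rule integral_eq_zero_AE)
    then show ?thesis by (simp add: Lp_norm_def)
  next
    case False
    then have s: "0 < s" and sq: "s powr q = I"
      using I0 q by (auto simp: s_def Lp_norm_def powr_powr I_def)
    have "(LINT x|M. (norm (f x) / s) powr p) \<le> (LINT x|M. p / q * (norm (f x) / s) powr q + (1 - p / q))"
    proof (rule integral_mono)
      show "integrable M (\<lambda>x. (norm (f x) / s) powr p)"
        "integrable M (\<lambda>x. p / q * (norm (f x) / s) powr q + (1 - p / q))"
        using s int_p int_q by (simp_all add: powr_divide)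
      show "(norm (f x) / s) powr p \<le> p / q * (norm (f x) / s) powr q + (1 - p / q)" for x
        using s by (intro young) simp
    qed
    also have "\<dots> = p / q * (I / s powr q) + (1 - p / q)"
      using s int_q by (simp add: powr_divide I_def prob_space)
    also have "\<dots> = 1" using sq False by simp
    finally have "(LINT x|M. norm (f x) powr p) \<le> s powr p"
      using s by (simp add: powr_divide)
    then have "(LINT x|M. norm (f x) powr p) powr (1 / p) \<le> (s powr p) powr (1 / p)"
      using assms by (intro powr_mono2) (auto intro!: integral_nonneg_AE)
    then show ?thesis using s assms by (simp add: Lp_norm_def powr_powr s_def)
  qed
qed

text \<open>The Cauchy-Schwarz inequality, taken first for extended nonnegative integrals of the
  norms. The product is integrable because the sum of the squares dominates it, and this lets the
  inequality be read over the reals.\<close>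

lemma norm_integral_mult_le_Lp_norm2:
  fixes f g :: "'a \<Rightarrow> complex"
  assumes "f \<in> Lp_space M 2" "g \<in> Lp_space M 2"
  shows "norm (LINT x|M. f x * g x) \<le> Lp_norm M 2 f * Lp_norm M 2 g"
proof -
  have [measurable]: "f \<in> borel_measurable M" "g \<in> borel_measurable M"
    using assms by (auto simp: Lp_space_def)
  have f2: "integrable M (\<lambda>x. (norm (f x))\<^sup>2)" and g2: "integrable M (\<lambda>x. (norm (g x))\<^sup>2)"
    using assms by (auto simp: Lp_space_def)
  define F where "F = (LINT x|M. (norm (f x))\<^sup>2)"
  define G where "G = (LINT x|M. (norm (g x))\<^sup>2)"
  define X where "X = (LINT x|M. norm (f x) * norm (g x))"
  have int: "integrable M (\<lambda>x. norm (f x) * norm (g x))"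
  proof (rule Bochner_Integration.integrable_bound)
    show "integrable M (\<lambda>x. (norm (f x))\<^sup>2 + (norm (g x))\<^sup>2)" using f2 g2 by simp
    show "AE x in M. norm (norm (f x) * norm (g x)) \<le> norm ((norm (f x))\<^sup>2 + (norm (g x))\<^sup>2)"
    proof (intro AE_I2)
      fix x
      have "2 * (norm (f x) * norm (g x)) \<le> (norm (f x))\<^sup>2 + (norm (g x))\<^sup>2"
        using sum_squares_bound[of "norm (f x)" "norm (g x)"] by simp
      moreover have "0 \<le> norm (f x) * norm (g x)" by simp
      ultimately have "norm (f x) * norm (g x) \<le> (norm (f x))\<^sup>2 + (norm (g x))\<^sup>2" by linarith
      then show "norm (norm (f x) * norm (g x)) \<le> norm ((norm (f x))\<^sup>2 + (norm (g x))\<^sup>2)" by simp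
    qed
  qed measurable
  have nn: "0 \<le> F" "0 \<le> G" "0 \<le> X" by (auto simp: F_def G_def X_def intro!: integral_nonneg_AE)
  have "(\<integral>\<^sup>+x. ennreal (norm (f x)) * ennreal (norm (g x)) \<partial>M)\<^sup>2
      \<le> (\<integral>\<^sup>+x. (ennreal (norm (f x)))\<^sup>2 \<partial>M) * (\<integral>\<^sup>+x. (ennreal (norm (g x)))\<^sup>2 \<partial>M)"
    by (intro Cauchy_Schwarz_nn_integral) auto
  also have "(\<integral>\<^sup>+x. ennreal (norm (f x)) * ennreal (norm (g x)) \<partial>M) = ennreal X"
    using nn_integral_eq_integral[OF int] by (simp add: X_def ennreal_mult)
  also have "(\<integral>\<^sup>+x. (ennreal (norm (f x)))\<^sup>2 \<partial>M) = ennreal F"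
    using nn_integral_eq_integral[OF f2] by (simp add: F_def ennreal_power)
  also have "(\<integral>\<^sup>+x. (ennreal (norm (g x)))\<^sup>2 \<partial>M) = ennreal G"
    using nn_integral_eq_integral[OF g2] by (simp add: G_def ennreal_power)
  finally have "X\<^sup>2 \<le> F * G"
    using nn by (simp add: ennreal_power ennreal_mult[symmetric])
  then have "X \<le> sqrt F * sqrt G"
    by (metis real_le_rsqrt real_sqrt_mult)
  moreover have "norm (LINT x|M. f x * g x) \<le> X"
    unfolding X_def using integral_norm_bound[of M "\<lambda>x. f x * g x"] by (simp add: norm_mult)
  ultimately show ?thesis
    using nn by (simp add: Lp_norm_def F_def G_def powr_half_sqrt)
qed

section \<open>The operator norm as a supremum of quotients\<close>

lemma Lp_norm_nonneg: "0 \<le> Lp_norm M p f"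
  by (simp add: Lp_norm_def)

lemma bounded_Lp_Lq_operator_bdd_above:
  assumes "bounded_Lp_Lq_operator M p q B"
  shows "bdd_above ((\<lambda>f. Lp_norm M q (B f) / Lp_norm M p f) ` Lp_space M p)"
proof -
  obtain K where K: "\<forall>f\<in>Lp_space M p. Lp_norm M q (B f) \<le> K * Lp_norm M p f"
    using assms unfolding bounded_Lp_Lq_operator_def by blast
  \<comment> \<open>\<open>K\<close> may be negative, and the quotient is 0 by the convention on
    division when \<open>f\<close> has norm 0; \<open>max K 0\<close> covers both.\<close>
  have "Lp_norm M q (B f) / Lp_norm M p f \<le> max K 0" if "f \<in> Lp_space M p" for f
  proof (cases "Lp_norm M p f = 0")
    case False
    then have "0 < Lp_norm M p f" using Lp_norm_nonneg[of M p f] by linarith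
    then have "Lp_norm M q (B f) / Lp_norm M p f \<le> K" using K that by (simp add: divide_le_eq)
    then show ?thesis by simp
  qed simp
  then show ?thesis by (auto intro!: bdd_aboveI)
qed

lemma Lp_norm_le_Lp_Lq_onorm:
  assumes B: "bounded_Lp_Lq_operator M p q B" and f: "f \<in> Lp_space M p"
  shows "Lp_norm M q (B f) \<le> Lp_Lq_onorm M p q B * Lp_norm M p f"
proof (cases "Lp_norm M p f = 0")
  \<comment> \<open>The supremum carries no information here, since the quotient is 0 by convention;
    the boundedness constant forces \<open>B f\<close> to have norm 0.\<close>
  case True
  moreover obtain K where "\<forall>f\<in>Lp_space M p. Lp_norm M q (B f) \<le> K * Lp_norm M p f"
    using B unfolding bounded_Lp_Lq_operator_def by blast
  ultimately show ?thesis using f by force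
next
  case False
  then have pos: "0 < Lp_norm M p f" using Lp_norm_nonneg[of M p f] by linarith
  have "Lp_norm M q (B f) / Lp_norm M p f \<le> Lp_Lq_onorm M p q B"
    unfolding Lp_Lq_onorm_def by (rule cSUP_upper[OF f bounded_Lp_Lq_operator_bdd_above[OF B]])
  then show ?thesis using pos by (simp add: divide_simps)
qed

lemma Lp_Lq_onorm_nonneg:
  assumes B: "bounded_Lp_Lq_operator M p q B"
  shows "0 \<le> Lp_Lq_onorm M p q B"
proof -
  have z: "(\<lambda>x. 0) \<in> Lp_space M p" by (simp add: Lp_space_def)
  have "0 \<le> Lp_norm M q (B (\<lambda>x. 0)) / Lp_norm M p (\<lambda>x. 0)"
    by (simp add: Lp_norm_nonneg)
  also have "\<dots> \<le> Lp_Lq_onorm M p q B"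
    unfolding Lp_Lq_onorm_def by (rule cSUP_upper[OF z bounded_Lp_Lq_operator_bdd_above[OF B]])
  finally show ?thesis .
qed

section \<open>The compact group SU(2)\<close>

text \<open>On \<open>SU2\<close> this is the inverse, in a form that is continuous on all
  matrices.\<close>

definition adjoint :: "cmat2 \<Rightarrow> cmat2" where
  "adjoint u = (\<chi> i j. cnj (u $ j $ i))"

lemma adjoint_adjoint [simp]: "adjoint (adjoint u) = u"
  by (simp add: adjoint_def vec_eq_iff)

lemma adjoint_matrix_mult: "adjoint (u ** v) = adjoint v ** adjoint u"
  by (simp add: adjoint_def vec_eq_iff matrix_matrix_mult_def mult.commute)

lemma SU2_iff: "u \<in> SU2 \<longleftrightarrow> u ** adjoint u = mat 1 \<and> det u = 1"
  by (simp add: SU2_def adjoint_def)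

lemma SU2_adjoint: "u \<in> SU2 \<Longrightarrow> adjoint u \<in> SU2"
  by (auto simp: SU2_iff matrix_left_right_inverse) (simp add: adjoint_def det_2 complex_eq_iff ac_simps)

lemma SU2_mult: "u \<in> SU2 \<Longrightarrow> v \<in> SU2 \<Longrightarrow> u ** v \<in> SU2"
  by (simp add: SU2_iff det_mul adjoint_matrix_mult)
    (metis matrix_mul_assoc matrix_mul_rid)

lemma continuous_on_matrix_mult [continuous_intros]:
  fixes f g :: "'a::topological_space \<Rightarrow> cmat2"
  assumes "continuous_on S f" "continuous_on S g"
  shows "continuous_on S (\<lambda>x. f x ** g x)"
  unfolding matrix_matrix_mult_def using assms by (intro continuous_intros)

lemma continuous_on_adjoint [continuous_intros]:
  assumes "continuous_on S f"
  shows "continuous_on S (\<lambda>x. adjoint (f x))"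
  unfolding adjoint_def using assms by (intro continuous_intros)

text \<open>The rows of a unitary matrix are unit vectors, so its entries have norm at most 1;
  closedness comes from the defining equations. Compactness makes continuous functions bounded,
  hence integrable.\<close>

lemma compact_SU2: "compact SU2"
  unfolding compact_eq_bounded_closed
proof
  have entry: "norm (u $ i $ j) \<le> 1" if "u \<in> SU2" for u and i j :: 2
  proof -
    have "(u ** adjoint u) $ i $ i = 1" using that by (simp add: SU2_iff mat_def)
    then have "(\<Sum>j\<in>UNIV. complex_of_real ((norm (u $ i $ j))\<^sup>2)) = 1"
      by (simp add: matrix_matrix_mult_def adjoint_def flip: complex_norm_square)
    then have "(\<Sum>j\<in>UNIV. (norm (u $ i $ j))\<^sup>2) = 1"
      by (metis of_real_eq_1_iff of_real_sum)
    moreover have "(norm (u $ i $ j))\<^sup>2 \<le> (\<Sum>j\<in>UNIV. (norm (u $ i $ j))\<^sup>2)"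
      by (intro member_le_sum) auto
    ultimately show ?thesis by (simp add: abs_square_le_1)
  qed
  have "norm u \<le> norm ((\<chi> i j. 1) :: cmat2)" if "u \<in> SU2" for u
    using entry[OF that] by (intro norm_le_componentwise_cart) (simp add: norm_le_componentwise_cart)
  then show "bounded SU2" by (auto simp: bounded_iff)
  have "closed {u :: cmat2. u ** adjoint u = mat 1 \<and> det u = 1}"
    unfolding det_2 by (intro closed_Collect_conj closed_Collect_eq continuous_intros)
  moreover have "SU2 = {u. u ** adjoint u = mat 1 \<and> det u = 1}"
    using SU2_iff by blast
  ultimately show "closed SU2" by metis
qed

section \<open>Inversion invariance of the Haar measure\<close>

locale haar_SU2 =
  fixes \<mu> :: "cmat2 measure"
  assumes haar: "normalized_haar_SU2 \<mu>"
begin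

lemma sets_haar [measurable_cong]: "sets \<mu> = sets (restrict_space borel SU2)"
  using haar by (simp add: normalized_haar_SU2_def)

lemma space_haar [simp]: "space \<mu> = SU2"
  using sets_eq_imp_space_eq[OF sets_haar] by (simp add: space_restrict_space)

sublocale prob_space \<mu>
  using haar by (intro prob_spaceI) (simp add: normalized_haar_SU2_def)

lemma borel_measurable_continuous:
  fixes f :: "cmat2 \<Rightarrow> 'b::topological_space"
  assumes "continuous_on UNIV f"
  shows "f \<in> borel_measurable \<mu>"
  using borel_measurable_continuous_onI[OF assms]
  by (subst measurable_cong_sets[OF sets_haar refl]) (rule measurable_restrict_space1)

lemma bounded_image_continuous:
  fixes f :: "cmat2 \<Rightarrow> complex"
  assumes "continuous_on UNIV f"
  obtains C where "\<And>u. u \<in> SU2 \<Longrightarrow> norm (f u) \<le> C"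
proof -
  have "bounded (f ` SU2)"
    using compact_SU2 assms
    by (intro compact_imp_bounded compact_continuous_image) (auto intro: continuous_on_subset)
  then show ?thesis using that by (auto simp: bounded_iff)
qed

lemma Lp_space_continuous:
  fixes f :: "cmat2 \<Rightarrow> complex"
  assumes "continuous_on UNIV f" "0 \<le> p"
  shows "f \<in> Lp_space \<mu> p"
proof -
  obtain C where C: "\<And>u. u \<in> SU2 \<Longrightarrow> norm (f u) \<le> C"
    using bounded_image_continuous[OF assms(1)] by blast
  have [measurable]: "f \<in> borel_measurable \<mu>" by (rule borel_measurable_continuous[OF assms(1)])
  have "integrable \<mu> (\<lambda>u. norm (f u) powr p)"
    using C assms(2) by (intro integrable_const_bound[of _ "C powr p"] AE_I2) (auto intro: powr_mono2)
  then show ?thesis by (simp add: Lp_space_def)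
qed

lemma integral_left_mult:
  fixes f :: "cmat2 \<Rightarrow> complex"
  assumes "continuous_on UNIV f" "g \<in> SU2"
  shows "(LINT u|\<mu>. f (g ** u)) = (LINT u|\<mu>. f u)"
proof -
  have "(\<lambda>u. g ** u) \<in> measurable \<mu> (restrict_space borel SU2)"
    using assms(2)
    by (intro measurable_restrict_space2 borel_measurable_continuous continuous_intros)
      (auto intro: SU2_mult)
  then have "(\<lambda>u. g ** u) \<in> measurable \<mu> \<mu>"
    by (subst measurable_cong_sets[OF refl sets_haar])
  then have "(LINT u|distr \<mu> \<mu> (\<lambda>u. g ** u). f u) = (LINT u|\<mu>. f (g ** u))"
    by (rule integral_distr) (rule borel_measurable_continuous[OF assms(1)])
  then show ?thesis using haar assms(2) by (simp add: normalized_haar_SU2_def)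
qed

text \<open>Left invariance turns both iterated integrals of \<open>f (adjoint v ** u)\<close> into single ones.\<close>

lemma integral_adjoint:
  fixes f :: "cmat2 \<Rightarrow> complex"
  assumes f: "continuous_on UNIV f"
  shows "(LINT u|\<mu>. f (adjoint u)) = (LINT u|\<mu>. f u)"
proof -
  interpret pair: pair_prob_space \<mu> \<mu> ..
  obtain C where C: "\<And>u. u \<in> SU2 \<Longrightarrow> norm (f u) \<le> C"
    using bounded_image_continuous[OF f] by blast
  have f': "continuous_on UNIV (\<lambda>u. f (adjoint u))"
    by (intro continuous_on_compose2[OF f] continuous_intros) auto
  \<comment> \<open>The integrand is continuous on the product of the matrix spaces, whose Borel
    sets are those of the product sigma-algebra; this is the measurability needed for
    Fubini.\<close>
  have meas: "(\<lambda>w. f (adjoint (fst w) ** snd w)) \<in> borel_measurable (\<mu> \<Otimes>\<^sub>M \<mu>)"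
  proof -
    have "(\<lambda>w. f (adjoint (fst w) ** snd w)) \<in> borel_measurable borel"
      by (intro borel_measurable_continuous_onI continuous_on_compose2[OF f] continuous_intros) auto
    moreover have "(\<lambda>w. (fst w, snd w)) \<in> measurable (\<mu> \<Otimes>\<^sub>M \<mu>) (borel \<Otimes>\<^sub>M borel)"
      by (intro measurable_Pair measurable_compose[OF measurable_fst] measurable_compose[OF measurable_snd]
          borel_measurable_continuous continuous_on_id)
    ultimately show ?thesis by (simp add: borel_prod measurable_compose)
  qed
  have "integrable (\<mu> \<Otimes>\<^sub>M \<mu>) (\<lambda>w. f (adjoint (fst w) ** snd w))"
  proof (rule pair.integrable_const_bound[OF AE_I2 meas])
    fix w assume "w \<in> space (\<mu> \<Otimes>\<^sub>M \<mu>)"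
    then have "fst w \<in> SU2" "snd w \<in> SU2" by (auto simp: space_pair_measure)
    then show "norm (f (adjoint (fst w) ** snd w)) \<le> C" by (intro C SU2_mult SU2_adjoint)
  qed
  then have int: "integrable (\<mu> \<Otimes>\<^sub>M \<mu>) (\<lambda>(v, u). f (adjoint v ** u))"
    by (simp only: split_beta')
  \<comment> \<open>A dummy integration over \<open>v\<close> is free because the total mass is
    1.\<close>
  have "(LINT u|\<mu>. f u) = (LINT v|\<mu>. LINT u|\<mu>. f u)"
    using prob_space by simp
  also have "\<dots> = (LINT v|\<mu>. LINT u|\<mu>. f (adjoint v ** u))"
    by (rule Bochner_Integration.integral_cong[OF refl])
      (simp only: space_haar integral_left_mult[OF f SU2_adjoint])
  also have "\<dots> = (LINT u|\<mu>. LINT v|\<mu>. f (adjoint v ** u))"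
    by (rule pair.Fubini_integral[OF int, symmetric])
  \<comment> \<open>As a function of \<open>v\<close>, the integrand is now a left translate of
    \<open>f\<close> composed with inversion.\<close>
  also have "\<dots> = (LINT u|\<mu>. LINT v|\<mu>. f (adjoint (adjoint u ** v)))"
    by (simp only: adjoint_matrix_mult adjoint_adjoint)
  also have "\<dots> = (LINT u|\<mu>. LINT v|\<mu>. f (adjoint v))"
    by (rule Bochner_Integration.integral_cong[OF refl])
      (simp only: space_haar integral_left_mult[OF f' SU2_adjoint])
  also have "\<dots> = (LINT u|\<mu>. f (adjoint u))"
    using prob_space by simp
  finally show ?thesis by simp
qed

text \<open>Inversion conjugates right translation by \<open>g\<close> into left translation by
  \<open>adjoint g\<close>, so right invariance follows from left invariance and
  \<open>integral_adjoint\<close>.\<close>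

lemma integral_right_mult:
  fixes f :: "cmat2 \<Rightarrow> complex"
  assumes f: "continuous_on UNIV f" and g: "g \<in> SU2"
  shows "(LINT u|\<mu>. f (u ** g)) = (LINT u|\<mu>. f u)"
proof -
  have "(LINT u|\<mu>. f (u ** g)) = (LINT u|\<mu>. f (adjoint u ** g))"
    by (rule integral_adjoint[symmetric]) (intro continuous_on_compose2[OF f] continuous_intros; simp)
  also have "\<dots> = (LINT u|\<mu>. f (adjoint (adjoint g ** u)))"
    by (simp add: adjoint_matrix_mult)
  also have "\<dots> = (LINT u|\<mu>. f (adjoint u))"
    by (rule integral_left_mult[OF _ SU2_adjoint[OF g]])
      (intro continuous_on_compose2[OF f] continuous_intros; simp)
  also have "\<dots> = (LINT u|\<mu>. f u)" by (rule integral_adjoint[OF f])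
  finally show ?thesis .
qed

end

section \<open>Polynomial functions of matrix entries\<close>

text \<open>A class that contains the matrix coefficients and their conjugates and is stable under
  the left-invariant derivatives, so that smoothness follows by induction on the word of
  derivatives.\<close>

inductive entry_polynomial :: "(cmat2 \<Rightarrow> complex) \<Rightarrow> bool" where
  const: "entry_polynomial (\<lambda>u. c)"
| entry: "entry_polynomial (\<lambda>u. u $ i $ j)"
| cnj: "entry_polynomial f \<Longrightarrow> entry_polynomial (\<lambda>u. cnj (f u))"
| add: "entry_polynomial f \<Longrightarrow> entry_polynomial g \<Longrightarrow> entry_polynomial (\<lambda>u. f u + g u)"
| mult: "entry_polynomial f \<Longrightarrow> entry_polynomial g \<Longrightarrow> entry_polynomial (\<lambda>u. f u * g u)"

lemma entry_polynomial_sum: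
  "(\<And>i. i \<in> I \<Longrightarrow> entry_polynomial (f i)) \<Longrightarrow> entry_polynomial (\<lambda>u. \<Sum>i\<in>I. f i u)"
  by (induction I rule: infinite_finite_induct) (auto intro: entry_polynomial.intros)

lemma entry_polynomial_continuous:
  "entry_polynomial f \<Longrightarrow> continuous_on UNIV f"
  by (induction rule: entry_polynomial.induct) (auto intro!: continuous_intros)

section \<open>Derivatives along the one-parameter subgroups\<close>

lemma one_param_0: "one_param a 0 = mat 1"
  by (simp add: one_param_def vec_eq_iff matrix_matrix_mult_def mat_def)

lemma one_param_nth:
  "one_param a t $ i $ j = mat 1 $ i $ j * complex_of_real (cos (t / 2))
     + \<i> * pauli a $ i $ j * complex_of_real (sin (t / 2))"
  by (simp add: one_param_def matrix_matrix_mult_def mat_def if_distrib[of "\<lambda>x. x * _"] cong: if_cong)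

lemma one_param_nth_has_vector_derivative:
  "((\<lambda>t. one_param a t $ i $ j) has_vector_derivative (\<i> * pauli a $ i $ j / 2)) (at 0)"
proof -
  have "((\<lambda>t. cos (t / 2)) has_real_derivative 0) (at 0)"
    "((\<lambda>t. sin (t / 2)) has_real_derivative 1 / 2) (at 0)"
    by (auto intro!: derivative_eq_intros)
  note D = this[THEN has_vector_derivative_of_real, where 'a = complex]
  show ?thesis
    unfolding one_param_nth
    using has_vector_derivative_add[OF has_vector_derivative_mult_right[OF D(1)]
        has_vector_derivative_mult_right[OF D(2)]]
    by simp
qed

text \<open>The derivative of an entry is a linear combination of entries, and sums, products and
  conjugates follow the usual rules. One \<open>g\<close> serves all matrices \<open>u\<close>, so
  it equals \<open>lie_deriv a f\<close> as a function and the argument can be iterated.\<close>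

lemma entry_polynomial_has_vector_derivative:
  assumes "entry_polynomial f"
  shows "\<exists>g. entry_polynomial g \<and>
    (\<forall>u. ((\<lambda>t. f (u ** one_param a t)) has_vector_derivative g u) (at 0))"
  using assms
proof (induction rule: entry_polynomial.induct)
  case (const c)
  show ?case
    by (intro exI[of _ "\<lambda>u. 0"] conjI allI entry_polynomial.const has_vector_derivative_const)
next
  case (entry i j)
  have "((\<lambda>t. (u ** one_param a t) $ i $ j) has_vector_derivative (\<Sum>l\<in>UNIV. u $ i $ l * (\<i> * pauli a $ l $ j / 2))) (at 0)" for u
    unfolding matrix_matrix_mult_def
    by (simp only: vec_lambda_beta)
      (intro has_vector_derivative_sum has_vector_derivative_mult_right one_param_nth_has_vector_derivative)
  then show ?case
    by (intro exI[of _ "\<lambda>u. \<Sum>l\<in>UNIV. u $ i $ l * (\<i> * pauli a $ l $ j / 2)"] conjI allI entry_polynomial_sum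
        entry_polynomial.mult entry_polynomial.entry entry_polynomial.const)
next
  case (cnj f)
  then obtain g where g: "entry_polynomial g"
    "\<And>u. ((\<lambda>t. f (u ** one_param a t)) has_vector_derivative g u) (at 0)" by blast
  show ?case
    by (intro exI[of _ "\<lambda>u. cnj (g u)"] conjI allI entry_polynomial.cnj has_vector_derivative_cnj g)
next
  case (add f1 f2)
  then obtain g1 g2 where g: "entry_polynomial g1" "entry_polynomial g2"
    "\<And>u. ((\<lambda>t. f1 (u ** one_param a t)) has_vector_derivative g1 u) (at 0)"
    "\<And>u. ((\<lambda>t. f2 (u ** one_param a t)) has_vector_derivative g2 u) (at 0)" by blast
  show ?case
    by (intro exI[of _ "\<lambda>u. g1 u + g2 u"] conjI allI entry_polynomial.add has_vector_derivative_add g)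
next
  case (mult f1 f2)
  then obtain g1 g2 where g: "entry_polynomial g1" "entry_polynomial g2"
    "\<And>u. ((\<lambda>t. f1 (u ** one_param a t)) has_vector_derivative g1 u) (at 0)"
    "\<And>u. ((\<lambda>t. f2 (u ** one_param a t)) has_vector_derivative g2 u) (at 0)" by blast
  have "((\<lambda>t. f1 (u ** one_param a t) * f2 (u ** one_param a t)) has_vector_derivative
      f1 u * g2 u + g1 u * f2 u) (at 0)" for u
    using has_vector_derivative_mult[OF g(3)[of u] g(4)[of u]] by (simp add: one_param_0)
  then show ?case
    by (intro exI[of _ "\<lambda>u. f1 u * g2 u + g1 u * f2 u"] conjI allI entry_polynomial.add
        entry_polynomial.mult g mult.hyps)
qed

lemma entry_polynomial_iter_deriv:
  assumes "entry_polynomial f"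
  shows "entry_polynomial (iter_deriv w f)"
proof (induction w)
  case Nil
  then show ?case using assms by simp
next
  case (Cons a w)
  obtain g where g: "entry_polynomial g"
    "\<And>u. ((\<lambda>t. iter_deriv w f (u ** one_param a t)) has_vector_derivative g u) (at 0)"
    using entry_polynomial_has_vector_derivative[OF Cons] by blast
  have "lie_deriv a (iter_deriv w f) = g"
    unfolding lie_deriv_def by (intro ext vector_derivative_at g(2))
  then show ?case by (simp only: iter_deriv.simps g(1))
qed

text \<open>This admits matrix coefficients as arguments of the operator and their conjugates as
  test functions.\<close>

lemma entry_polynomial_smooth:
  assumes "entry_polynomial f"
  shows "smooth_SU2 f"
  unfolding smooth_SU2_def
proof (intro allI conjI ballI)
  fix w
  note w = entry_polynomial_iter_deriv[OF assms, of w]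
  show "continuous_on SU2 (iter_deriv w f)"
    using entry_polynomial_continuous[OF w] by (rule continuous_on_subset) simp
  fix a u
  show "(\<lambda>t. iter_deriv w f (u ** one_param a t)) differentiable at 0"
    using entry_polynomial_has_vector_derivative[OF w, of a] by (blast intro: differentiableI_vector)
qed

section \<open>Matrix coefficients\<close>

text \<open>At \<open>z = (1, x)\<close> both sides become polynomials in \<open>x\<close>, whose
  coefficients can be compared. Vanishing beyond \<open>k\<close> determines the sequences at all
  indices, as the definite description in \<open>rep_matrix\<close> requires.\<close>

lemma std_basis_independent:
  assumes "\<And>m. m > k \<Longrightarrow> c m = 0" "\<And>m. m > k \<Longrightarrow> d m = 0"
    and "\<And>z. (\<Sum>m\<le>k. c m * std_basis k m z) = (\<Sum>m\<le>k. d m * std_basis k m z)"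
  shows "c = d"
proof -
  define s where "s m = complex_of_real (sqrt (fact (k - m) * fact m))" for m
  have s: "s m \<noteq> 0" for m by (simp add: s_def)
  have "(\<Sum>m\<le>k. (c m / s m) * x ^ m) = (\<Sum>m\<le>k. (d m / s m) * x ^ m)" for x
    using assms(3)[of "vector [1, x]"] by (simp add: std_basis_def s_def)
  then have "\<forall>m\<le>k. c m / s m = d m / s m"
    by (subst polyfun_eq_coeffs[symmetric]) simp
  then show ?thesis using assms(1,2) s by (intro ext) (metis divide_cancel_right not_le)
qed

text \<open>The image under \<open>rep u\<close> of the monomial of index \<open>j\<close>, without
  its normalization, restricted to \<open>z = (1, x)\<close>.\<close>

definition column_poly :: "nat \<Rightarrow> nat \<Rightarrow> cmat2 \<Rightarrow> complex poly" where
  "column_poly k j u = [:u $ 1 $ 1, u $ 2 $ 1:] ^ (k - j) * [:u $ 1 $ 2, u $ 2 $ 2:] ^ j"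

lemma entry_polynomial_coeff_mult:
  assumes "\<And>m. entry_polynomial (\<lambda>u. coeff (P u) m)" "\<And>m. entry_polynomial (\<lambda>u. coeff (Q u) m)"
  shows "entry_polynomial (\<lambda>u. coeff (P u * Q u) m)"
  unfolding coeff_mult using assms by (intro entry_polynomial_sum entry_polynomial.mult)

lemma entry_polynomial_coeff_power:
  assumes "\<And>m. entry_polynomial (\<lambda>u. coeff (P u) m)"
  shows "entry_polynomial (\<lambda>u. coeff (P u ^ n) m)"
proof (induction n arbitrary: m)
  case 0
  then show ?case by (simp add: entry_polynomial.const)
next
  case (Suc n)
  then show ?case using assms by (simp add: entry_polynomial_coeff_mult)
qed

lemma entry_polynomial_coeff_column_poly: "entry_polynomial (\<lambda>u. coeff (column_poly k j u) m)"
proof -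
  have "entry_polynomial (\<lambda>u. coeff [:u $ 1 $ l, u $ 2 $ l:] m)" for l m
  proof (cases m)
    case 0
    then show ?thesis by (simp add: entry_polynomial.entry)
  next
    case (Suc m')
    then show ?thesis by (cases m') (simp_all add: entry_polynomial.entry entry_polynomial.const)
  qed
  then show ?thesis unfolding column_poly_def
    by (intro entry_polynomial_coeff_mult entry_polynomial_coeff_power)
qed

text \<open>For polynomials of degree at most \<open>n\<close> this reverses the restriction to
  \<open>z = (1, x)\<close>.\<close>

definition homogenize :: "nat \<Rightarrow> complex poly \<Rightarrow> complex^2 \<Rightarrow> complex" where
  "homogenize n P z = (\<Sum>m\<le>n. coeff P m * (z $ 1 ^ (n - m) * z $ 2 ^ m))"

lemma homogenize_linear_mult:
  assumes "degree P \<le> n"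
  shows "homogenize (Suc n) ([:a, b:] * P) z = (a * z $ 1 + b * z $ 2) * homogenize n P z"
proof -
  have "homogenize (Suc n) ([:a, b:] * P) z =
      (\<Sum>m\<le>Suc n. a * coeff P m * (z $ 1 ^ (Suc n - m) * z $ 2 ^ m)) +
      (\<Sum>m\<le>Suc n. coeff (pCons 0 (smult b P)) m * (z $ 1 ^ (Suc n - m) * z $ 2 ^ m))"
    by (simp add: homogenize_def algebra_simps flip: sum.distrib del: sum.atMost_Suc)
  \<comment> \<open>The extra term \<open>m = Suc n\<close> vanishes by the degree bound. In the
    other sum it is the term \<open>m = 0\<close> that vanishes, and an index shift removes
    it.\<close>
  also have "(\<Sum>m\<le>Suc n. a * coeff P m * (z $ 1 ^ (Suc n - m) * z $ 2 ^ m)) =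
      a * z $ 1 * homogenize n P z"
    using assms
    by (simp add: homogenize_def sum_distrib_left coeff_eq_0 Suc_diff_le ac_simps)
  also have "(\<Sum>m\<le>Suc n. coeff (pCons 0 (smult b P)) m * (z $ 1 ^ (Suc n - m) * z $ 2 ^ m)) =
      b * z $ 2 * homogenize n P z"
    by (simp add: homogenize_def sum_distrib_left sum.atMost_Suc_shift ac_simps del: sum.atMost_Suc)
  finally show ?thesis by (simp add: algebra_simps)
qed

lemma homogenize_power_mult:
  assumes "degree P \<le> n"
  shows "degree ([:a, b:] ^ r * P) \<le> r + n \<and>
    homogenize (r + n) ([:a, b:] ^ r * P) z = (a * z $ 1 + b * z $ 2) ^ r * homogenize n P z"
proof (induction r)
  case 0
  then show ?case using assms by simp
next
  case (Suc r)
  define Q where "Q = [:a, b:] ^ r * P"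
  have "degree ([:a, b:] * Q) \<le> Suc (r + n)"
    using degree_mult_le[of "[:a, b:]" Q] Suc by (simp add: Q_def split: if_splits)
  moreover have "homogenize (Suc (r + n)) ([:a, b:] * Q) z =
      (a * z $ 1 + b * z $ 2) * homogenize (r + n) Q z"
    using Suc by (intro homogenize_linear_mult) (simp add: Q_def)
  moreover have "[:a, b:] ^ Suc r * P = [:a, b:] * Q"
    by (simp only: Q_def power_Suc mult.assoc)
  ultimately show ?case using Suc by (simp only: add_Suc) (simp add: Q_def)
qed

lemma homogenize_column_poly:
  assumes "j \<le> k"
  shows "homogenize k (column_poly k j u) z = ((z v* u) $ 1) ^ (k - j) * ((z v* u) $ 2) ^ j"
proof -
  define P where "P = [:u $ 1 $ 2, u $ 2 $ 2:] ^ j"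
  \<comment> \<open>Powers are homogenized twice: those of the second column of \<open>u\<close>
    starting from the constant 1 in degree 0, then those of the first column starting from
    \<open>P\<close>.\<close>
  have P: "degree P \<le> j" "homogenize j P z = ((z v* u) $ 2) ^ j"
    using homogenize_power_mult[of 1 0 "u $ 1 $ 2" "u $ 2 $ 2" j z]
    by (simp_all add: P_def homogenize_def vector_matrix_mult_def sum_2 ac_simps)
  show ?thesis
    using homogenize_power_mult[OF P(1), of "u $ 1 $ 1" "u $ 2 $ 1" "k - j" z] assms
    by (simp add: P(2)) (simp add: P_def column_poly_def vector_matrix_mult_def sum_2 ac_simps)
qed

section \<open>Entries of the representation matrices\<close>

definition std_basis_norm :: "nat \<Rightarrow> nat \<Rightarrow> complex" where
  "std_basis_norm k m = complex_of_real (sqrt (fact (k - m) * fact m))"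

lemma std_basis_norm_nonzero [simp]: "std_basis_norm k m \<noteq> 0"
  by (simp add: std_basis_norm_def)

text \<open>By linear independence of the basis, any expansion that is zero beyond \<open>k\<close>
  is the one selected by the definite description.\<close>

lemma rep_matrix_unique:
  assumes "\<And>m. m > k \<Longrightarrow> c m = 0"
    and "\<And>z. std_basis k j (z v* u) = (\<Sum>m\<le>k. c m * std_basis k m z)"
  shows "rep_matrix k u m j = c m"
proof -
  have "(THE c. (\<forall>m>k. c m = 0) \<and> (\<forall>z. rep u (std_basis k j) z = (\<Sum>m\<le>k. c m * std_basis k m z))) = c"
  proof (rule the_equality)
    fix d
    assume "(\<forall>m>k. d m = 0) \<and> (\<forall>z. rep u (std_basis k j) z = (\<Sum>m\<le>k. d m * std_basis k m z))"
    then show "d = c" using assms by (intro std_basis_independent[of k]) (auto simp: rep_def)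
  qed (use assms in \<open>simp add: rep_def\<close>)
  then show ?thesis by (simp add: rep_matrix_def)
qed

lemma
  assumes j: "j \<le> k"
  shows rep_matrix_eq: "rep_matrix k u m j =
      (if m \<le> k then coeff (column_poly k j u) m * std_basis_norm k m / std_basis_norm k j else 0)"
    and rep_matrix_expansion:
      "std_basis k j (z v* u) = (\<Sum>m\<le>k. rep_matrix k u m j * std_basis k m z)"
proof -
  define c where "c m = (if m \<le> k then
      coeff (column_poly k j u) m * std_basis_norm k m / std_basis_norm k j else 0)" for m
  have *: "std_basis k j (z v* u) = (\<Sum>m\<le>k. c m * std_basis k m z)" for z
  proof -
    have "std_basis k j (z v* u) = homogenize k (column_poly k j u) z / std_basis_norm k j"
      by (simp add: homogenize_column_poly[OF j] std_basis_def std_basis_norm_def)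
    also have "\<dots> = (\<Sum>m\<le>k. c m * std_basis k m z)"
      unfolding homogenize_def sum_divide_distrib
    proof (intro sum.cong refl)
      fix m assume "m \<in> {..k}"
      moreover have "std_basis k m z = z $ 1 ^ (k - m) * z $ 2 ^ m / std_basis_norm k m"
        by (simp add: std_basis_def std_basis_norm_def)
      ultimately show "coeff (column_poly k j u) m * (z $ 1 ^ (k - m) * z $ 2 ^ m) / std_basis_norm k j
          = c m * std_basis k m z"
        by (simp add: c_def)
    qed
    finally show ?thesis .
  qed
  have rep: "rep_matrix k u m j = c m" for m
    by (rule rep_matrix_unique[OF _ *]) (simp add: c_def)
  show "rep_matrix k u m j =
      (if m \<le> k then coeff (column_poly k j u) m * std_basis_norm k m / std_basis_norm k j else 0)"
    by (simp only: rep c_def)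
  show "std_basis k j (z v* u) = (\<Sum>m\<le>k. rep_matrix k u m j * std_basis k m z)"
    by (simp only: rep *)
qed

lemma entry_polynomial_rep_matrix:
  assumes "j \<le> k"
  shows "entry_polynomial (\<lambda>u. rep_matrix k u m j)"
proof (cases "m \<le> k")
  case True
  have "entry_polynomial (\<lambda>u. coeff (column_poly k j u) m * (std_basis_norm k m / std_basis_norm k j))"
    by (intro entry_polynomial.mult entry_polynomial_coeff_column_poly entry_polynomial.const)
  then show ?thesis using True by (simp add: rep_matrix_eq[OF assms])
next
  case False
  then show ?thesis by (simp add: rep_matrix_eq[OF assms] entry_polynomial.const)
qed

text \<open>Right multiplication by a diagonal matrix scales the columns of \<open>u\<close>, hence
  the linear factors of \<open>column_poly\<close>.\<close>

lemma rep_matrix_mult_diagonal: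
  assumes "j \<le> k" "d $ 1 $ 2 = 0" "d $ 2 $ 1 = 0"
  shows "rep_matrix k (u ** d) m j = d $ 1 $ 1 ^ (k - j) * d $ 2 $ 2 ^ j * rep_matrix k u m j"
proof -
  have "[:(u ** d) $ 1 $ l, (u ** d) $ 2 $ l:] = smult (d $ l $ l) [:u $ 1 $ l, u $ 2 $ l:]" for l
    using assms exhaust_2[of l] by (auto simp: matrix_matrix_mult_def sum_2)
  then have "column_poly k j (u ** d) = smult (d $ 1 $ 1 ^ (k - j) * d $ 2 $ 2 ^ j) (column_poly k j u)"
    by (simp only: column_poly_def smult_power mult_smult_left mult_smult_right smult_smult mult.commute)
  then show ?thesis using assms by (simp add: rep_matrix_eq)
qed

section \<open>Orthogonality within a row and the bound on the diagonal of the symbol\<close>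

context haar_SU2
begin

lemma integral_rep_matrix_orthogonal:
  assumes ij: "i \<le> k" "j \<le> k" "i \<noteq> j"
  shows "(LINT u|\<mu>. rep_matrix k u m i * cnj (rep_matrix k u m j)) = 0"
proof -
  \<comment> \<open>Chosen so that the phases of columns \<open>i\<close> and \<open>j\<close>
    differ by the angle \<open>pi\<close>: the integrand changes sign under right translation by
    \<open>d\<close>, and its integral equals its own negative.\<close>
  define x where "x = pi / (2 * (real j - real i))"
  \<comment> \<open>The factor 2 undoes the half angle in \<open>one_param\<close>, so
    \<open>d\<close> is diagonal with entries \<open>cis x\<close> and
    \<open>cis (- x)\<close>.\<close>
  define d where "d = one_param AxisZ (2 * x)"
  have d: "d $ 1 $ 2 = 0" "d $ 2 $ 1 = 0" "d $ 1 $ 1 = cis x" "d $ 2 $ 2 = cis (- x)"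
    by (auto simp: d_def one_param_nth mat_def complex_eq_iff)
  have phase: "rep_matrix k (u ** d) m l = cis ((real k - 2 * real l) * x) * rep_matrix k u m l"
    if "l \<le> k" for u l
  proof -
    have "cis x ^ (k - l) * cis (- x) ^ l = cis ((real k - 2 * real l) * x)"
      using that by (simp only: Complex.DeMoivre cis_mult of_nat_diff) (simp add: algebra_simps)
    then show ?thesis using that by (simp add: rep_matrix_mult_diagonal d)
  qed
  have "(real k - 2 * real i) * x - (real k - 2 * real j) * x = 2 * (real j - real i) * x"
    by (simp add: algebra_simps)
  also have "\<dots> = pi" using ij by (simp add: x_def)
  finally have "(real k - 2 * real i) * x - (real k - 2 * real j) * x = pi" .
  then have "cis ((real k - 2 * real i) * x) * cnj (cis ((real k - 2 * real j) * x)) = - 1"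
    by (simp add: cis_cnj cis_mult)
  then have "rep_matrix k (u ** d) m i * cnj (rep_matrix k (u ** d) m j) =
      - (rep_matrix k u m i * cnj (rep_matrix k u m j))" for u
    using ij by (simp add: phase mult.left_commute flip: mult.assoc)
  moreover have "continuous_on UNIV (\<lambda>u. rep_matrix k u m i * cnj (rep_matrix k u m j))"
    using ij
    by (intro entry_polynomial_continuous entry_polynomial.mult entry_polynomial.cnj
        entry_polynomial_rep_matrix)
  ultimately have "(LINT u|\<mu>. - (rep_matrix k u m i * cnj (rep_matrix k u m j))) =
      (LINT u|\<mu>. rep_matrix k u m i * cnj (rep_matrix k u m j))"
    using integral_right_mult[of "\<lambda>u. rep_matrix k u m i * cnj (rep_matrix k u m j)" d]
    by (simp add: d_def one_param_in_SU2)
  then show ?thesis by simp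
qed

lemma exists_rep_matrix_norm_pos:
  assumes i: "i \<le> k"
  shows "\<exists>j. 0 < (LINT u|\<mu>. (norm (rep_matrix k u j i))\<^sup>2)"
proof (rule ccontr)
  assume neg: "\<not> ?thesis"
  have "AE u in \<mu>. rep_matrix k u j i = 0" for j
  proof -
    have "(\<lambda>u. rep_matrix k u j i) \<in> Lp_space \<mu> 2"
      using i by (intro Lp_space_continuous entry_polynomial_continuous entry_polynomial_rep_matrix) auto
    then have int: "integrable \<mu> (\<lambda>u. (norm (rep_matrix k u j i))\<^sup>2)" by (simp add: Lp_space_def)
    have "0 \<le> (LINT u|\<mu>. (norm (rep_matrix k u j i))\<^sup>2)" by (intro integral_nonneg_AE) auto
    then have "(LINT u|\<mu>. (norm (rep_matrix k u j i))\<^sup>2) = 0"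
      using neg by (metis order_le_less)
    then show ?thesis using integral_nonneg_eq_0_iff_AE[OF int] by simp
  qed
  \<comment> \<open>Countably many null sets are discarded together; since the total mass is 1, some
    point \<open>u\<close> of \<open>SU2\<close> remains where the whole column vanishes. Undoing
    \<open>u\<close> by its adjoint then gives \<open>std_basis k i\<close> the value 0 at
    \<open>(1, 1)\<close>, which is absurd.\<close>
  then have "AE u in \<mu>. \<forall>j. rep_matrix k u j i = 0"
    by (simp add: AE_all_countable)
  then have "AE u in \<mu>. u \<in> SU2 \<and> (\<forall>j. rep_matrix k u j i = 0)"
    using AE_space by eventually_elim simp
  then obtain u where u: "u \<in> SU2" "\<And>j. rep_matrix k u j i = 0"
    using eventually_happens'[OF ae_filter_bot] by blast
  have "adjoint u ** u = mat 1"
    using u(1) by (simp add: SU2_iff matrix_left_right_inverse)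
  then have "std_basis k i (vector [1, 1]) = std_basis k i ((vector [1, 1] v* adjoint u) v* u)"
    by (simp add: vector_matrix_mul_assoc)
  also have "\<dots> = 0" by (simp add: rep_matrix_expansion[OF i] u(2))
  finally show False by (simp add: std_basis_def)
qed

lemma symbol_diagonal_le_onorm:
  assumes p: "1 < p" "p \<le> 2" "2 \<le> q" and i: "i \<le> k"
    and symbol: "is_symbol \<mu> A \<sigma>" and ext: "bounded_Lp_Lq_extension \<mu> p q A B"
  shows "cmod (\<sigma> k i i) \<le> Lp_Lq_onorm \<mu> p q B"
proof -
  define N where "N = Lp_Lq_onorm \<mu> p q B"
  obtain j where j: "0 < (LINT u|\<mu>. (norm (rep_matrix k u j i))\<^sup>2)"
    using exists_rep_matrix_norm_pos[OF i] by blast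
  \<comment> \<open>Entries with a row index beyond \<open>k\<close> are 0 by convention, so a
    positive norm forces a genuine row.\<close>
  have "j \<le> k"
    using j by (cases "j \<le> k") (simp_all add: rep_matrix_eq[OF i])
  define f where "f u = rep_matrix k u j i" for u
  define I where "I = (LINT u|\<mu>. (norm (f u))\<^sup>2)"
  have I: "0 < I" using j by (simp add: I_def f_def)
  have poly: "entry_polynomial f" "entry_polynomial (\<lambda>u. cnj (f u))"
    unfolding f_def by (intro entry_polynomial.cnj entry_polynomial_rep_matrix i)+
  have Lp: "f \<in> Lp_space \<mu> r" "(\<lambda>u. cnj (f u)) \<in> Lp_space \<mu> r" if "0 \<le> r" for r
    using that poly by (auto intro!: Lp_space_continuous entry_polynomial_continuous)
  have B: "bounded_Lp_Lq_operator \<mu> p q B"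
    using ext by (simp add: bounded_Lp_Lq_extension_def)
  have N: "0 \<le> N" unfolding N_def by (rule Lp_Lq_onorm_nonneg[OF B])
  have Bf: "B f \<in> Lp_space \<mu> q"
    using B Lp(1)[of p] p by (auto simp: bounded_Lp_Lq_operator_def)
  have norm2: "Lp_norm \<mu> 2 f = sqrt I" "Lp_norm \<mu> 2 (\<lambda>u. cnj (f u)) = sqrt I"
    using I by (simp_all add: Lp_norm_def I_def powr_half_sqrt)
  \<comment> \<open>Testing against the conjugate of \<open>f\<close> is exactly taking the Fourier
    coefficient of \<open>A f\<close> in row \<open>i\<close> and column \<open>j\<close>.\<close>
  have "A f (\<lambda>u. cnj (f u)) = (\<Sum>m\<le>k. \<sigma> k i m * fourier_coeff \<mu> f k m j)"
    using symbol entry_polynomial_smooth[OF poly(1)] i \<open>j \<le> k\<close>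
    unfolding is_symbol_def fourier_coeff_dist_def f_def by blast
  \<comment> \<open>The coefficient of \<open>f\<close> with indices \<open>m\<close> and
    \<open>j\<close> pairs columns \<open>i\<close> and \<open>m\<close> of row \<open>j\<close>;
    orthogonality leaves only \<open>m = i\<close>.\<close>
  also have "\<dots> = (\<Sum>m\<le>k. if m = i then \<sigma> k i i * I else 0)"
  proof (intro sum.cong refl)
    fix m assume m: "m \<in> {..k}"
    have "fourier_coeff \<mu> f k i j = (LINT u|\<mu>. complex_of_real ((norm (f u))\<^sup>2))"
      unfolding fourier_coeff_def f_def complex_norm_square ..
    also have "\<dots> = complex_of_real I" by (simp only: I_def integral_complex_of_real)
    finally show "\<sigma> k i m * fourier_coeff \<mu> f k m j = (if m = i then \<sigma> k i i * I else 0)"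
      using integral_rep_matrix_orthogonal[of i k m j] i m by (auto simp: fourier_coeff_def f_def)
  qed
  also have "\<dots> = \<sigma> k i i * I" using i by simp
  finally have "cmod (\<sigma> k i i) * I = cmod (A f (\<lambda>u. cnj (f u)))"
    using I by (simp add: norm_mult)
  also have "A f (\<lambda>u. cnj (f u)) = (LINT u|\<mu>. B f u * cnj (f u))"
    using ext poly by (simp add: bounded_Lp_Lq_extension_def distribution_of_def entry_polynomial_smooth)
  also have "cmod \<dots> \<le> Lp_norm \<mu> 2 (B f) * sqrt I"
    using norm_integral_mult_le_Lp_norm2[OF Lp_space_mono(1)[OF _ p(3) Bf] Lp(2)[of 2]]
    by (simp add: norm2)
  \<comment> \<open>The exponent is raised from 2 to \<open>q\<close>, the operator bound applied,
    and \<open>p\<close> raised to 2; both changes of exponent cost no constant.\<close>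
  also have "\<dots> \<le> (N * sqrt I) * sqrt I"
  proof (intro mult_right_mono)
    have "Lp_norm \<mu> 2 (B f) \<le> Lp_norm \<mu> q (B f)"
      using p by (intro Lp_space_mono(2)[OF _ _ Bf]) auto
    also have "\<dots> \<le> N * Lp_norm \<mu> p f"
      unfolding N_def using p by (intro Lp_norm_le_Lp_Lq_onorm B Lp(1)) auto
    also have "\<dots> \<le> N * sqrt I"
      unfolding norm2(1)[symmetric] using N p
      by (intro mult_left_mono Lp_space_mono(2) Lp(1)) auto
    finally show "Lp_norm \<mu> 2 (B f) \<le> N * sqrt I" .
  qed (use I in simp)
  also have "\<dots> = N * I" using I by simp
  finally show ?thesis using I by (simp add: N_def)
qed

end

section \<open>From the diagonal bound to the minimum and the trace\<close>

theorem theorem3p1: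
  fixes p q p' :: real
  assumes "1 < p" and "p \<le> 2" and "2 \<le> q"
    and "1 / p + 1 / p' = 1"
  shows "\<exists>C>0. \<forall>\<mu> A \<sigma> B.
    normalized_haar_SU2 \<mu> \<longrightarrow>
    left_invariant_operator A \<longrightarrow>
    is_symbol \<mu> A \<sigma> \<longrightarrow>
    bounded_Lp_Lq_extension \<mu> p q A B \<longrightarrow>
      (SUP k::nat. ereal ((MIN i\<in>{..k}. cmod (\<sigma> k i i)) / real (k + 1) powr (1 / p' + 1 / q)))
        \<le> ereal (C * Lp_Lq_onorm \<mu> p q B) \<and>
      (SUP k::nat. ereal (cmod (\<Sum>i\<le>k. \<sigma> k i i) / real (k + 1) powr (1 + 1 / p' + 1 / q)))
        \<le> ereal (C * Lp_Lq_onorm \<mu> p q B)"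
proof (intro exI[of _ 1] conjI allI impI)
  fix \<mu> A \<sigma> B
  assume haar: "normalized_haar_SU2 \<mu>" and symbol: "is_symbol \<mu> A \<sigma>"
    and ext: "bounded_Lp_Lq_extension \<mu> p q A B"
  define N where "N = Lp_Lq_onorm \<mu> p q B"
  interpret haar_SU2 \<mu> by unfold_locales (rule haar)
  have diag: "cmod (\<sigma> k i i) \<le> N" if "i \<le> k" for k i
    unfolding N_def by (rule symbol_diagonal_le_onorm[OF assms(1-3) that symbol ext])
  \<comment> \<open>The index \<open>k = 0\<close>, the trivial representation, always supplies a
    diagonal entry.\<close>
  have N: "0 \<le> N" using diag[of 0 0] norm_ge_zero order_trans by blast
  have "1 / p < 1" using assms(1) by simp
  then have s: "0 \<le> 1 / p' + 1 / q" using assms by (intro add_nonneg_nonneg) (linarith, simp)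
  \<comment> \<open>Used with \<open>z = 1\<close> for the minimum and with
    \<open>z = k + 1\<close>, the dimension, for the trace; nonnegativity of
    \<open>1 / p' + 1 / q\<close> makes each denominator at least \<open>z\<close>.\<close>
  have weak: "x / y \<le> N" if "x \<le> N * z" "z \<le> y" "0 < y" for x y z :: real
    using that N by (simp add: divide_le_eq) (meson mult_left_mono order_trans)
  show "(SUP k::nat. ereal ((MIN i\<in>{..k}. cmod (\<sigma> k i i)) / real (k + 1) powr (1 / p' + 1 / q)))
      \<le> ereal (1 * Lp_Lq_onorm \<mu> p q B)"
  proof (intro SUP_least)
    fix k :: nat
    have "(MIN i\<in>{..k}. cmod (\<sigma> k i i)) \<le> cmod (\<sigma> k 0 0)" by (intro Min_le) auto
    also have "\<dots> \<le> N * 1" using diag[of 0 k] by simp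
    finally have *: "(MIN i\<in>{..k}. cmod (\<sigma> k i i)) \<le> N * 1" .
    have "(MIN i\<in>{..k}. cmod (\<sigma> k i i)) / real (k + 1) powr (1 / p' + 1 / q) \<le> N"
      using s by (intro weak[OF *]) (auto intro: ge_one_powr_ge_zero)
    then show "ereal ((MIN i\<in>{..k}. cmod (\<sigma> k i i)) / real (k + 1) powr (1 / p' + 1 / q))
        \<le> ereal (1 * Lp_Lq_onorm \<mu> p q B)" by (simp add: N_def)
  qed
  show "(SUP k::nat. ereal (cmod (\<Sum>i\<le>k. \<sigma> k i i) / real (k + 1) powr (1 + 1 / p' + 1 / q)))
      \<le> ereal (1 * Lp_Lq_onorm \<mu> p q B)"
  proof (intro SUP_least)
    fix k :: nat
    have "cmod (\<Sum>i\<le>k. \<sigma> k i i) \<le> (\<Sum>i\<le>k. N)"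
      using diag by (intro sum_norm_le) auto
    also have "\<dots> = N * real (k + 1)" by simp
    finally have *: "cmod (\<Sum>i\<le>k. \<sigma> k i i) \<le> N * real (k + 1)" .
    have "real (k + 1) powr 1 \<le> real (k + 1) powr (1 + 1 / p' + 1 / q)"
      using s by (intro powr_mono) auto
    then have "cmod (\<Sum>i\<le>k. \<sigma> k i i) / real (k + 1) powr (1 + 1 / p' + 1 / q) \<le> N"
      by (intro weak[OF *]) auto
    then show "ereal (cmod (\<Sum>i\<le>k. \<sigma> k i i) / real (k + 1) powr (1 + 1 / p' + 1 / q))
        \<le> ereal (1 * Lp_Lq_onorm \<mu> p q B)" by (simp add: N_def)
  qed
qed simp

end
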